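(* Let $(\gamma_n)_{n\in\mathbb{N}}$ and $(\delta_n)_{n\in\mathbb{N}}$ be sequences of independent random variables, each uniformly distributed (with respect to Lebesgue measure) in $[0,1)$. Let $\psi:\mathbb{N}\to[0,\infty)$ be a decreasing function and suppose that for some $\epsilon>0$, \[\limsup_{n\to\infty}\frac{1}{n^{4+\epsilon}}\exp\left((4-\epsilon)\sum_{m=1}^{n}\psi(m)\log\frac{1}{\psi(m)}\right)=\infty.\] Then almost surely (with respect to the values of $(\gamma_n)$ and $(\delta_n)$) the following holds: for all $\alpha,\beta\in\mathbb{R}$ there are infinitely many triples $(n,a,b)$ with $n\in\mathbb{N}$ and $a,b\in\mathbb{Z}$ such that \[\left|\alpha+\frac{\gamma_n}{n}-\frac{a}{n}\right|\cdot\left|\beta+\frac{\delta_n}{n}-\frac{b}{n}\right|\le\frac{\psi(n)}{n^2}.\]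
   Context: The random variables $\gamma_1,\gamma_2,\dots,\delta_1,\delta_2,\dots$ are all mutually independent. "Decreasing" means non-increasing. In the displayed hypothesis, the summand $\psi(m)\log(1/\psi(m))$ is to be interpreted as $0$ when $\psi(m)=0$. *)

theory Defs
  imports "HOL-Probability.Probability"
begin

end

theory Submission
  imports Defs "HOL-Real_Asymp.Real_Asymp"
begin

text \<open>
  For fixed \<open>(\<alpha>, \<beta>)\<close> the index \<open>m\<close> is a hit if \<open>\<parallel>m \<alpha> + \<gamma>\<^sub>m\<parallel> \<parallel>m \<beta> + \<delta>\<^sub>m\<parallel> \<le> \<psi> m\<close>, where \<open>\<parallel>x\<parallel>\<close> is the
  distance from \<open>x\<close> to the nearest integer. The two factors are independent and uniform on
  \<open>[0, 1/2]\<close>, so with \<open>\<eta> x = x ln (1/x)\<close> a hit has probability at least \<open>\<eta> (4 \<psi> m)\<close>, and all of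
  \<open>N, \<dots>, n\<close> are missed with probability at most \<open>exp (- (\<Sum>m = N..n. \<eta> (4 \<psi> m)))\<close>.

  To treat all \<open>(\<alpha>, \<beta>)\<close> at once, take the union bound over a grid of mesh \<open>n powr (- 2 - \<epsilon>/2)\<close>,
  which has about \<open>n powr (4 + \<epsilon>)\<close> points. Moving to a grid point perturbs the products with \<open>m \<le> n\<close>
  by at most \<open>\<kappa> = n powr (- 1 - \<epsilon>/2)\<close>. Since \<open>\<eta>\<close> is subadditive, replacing \<open>\<psi> m\<close> by \<open>\<psi> m - \<kappa>\<close> costs
  only \<open>O(\<kappa> + \<eta> \<kappa>)\<close> per index, in total \<open>o(1)\<close>; and \<open>\<eta> (4 t) \<ge> (4 - \<epsilon>) \<eta> t\<close> once \<open>t\<close> is small. Hence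
  the probability that some \<open>(\<alpha>, \<beta>)\<close> misses all of \<open>N, \<dots>, n\<close> tends to zero along a subsequence
  of \<open>n\<close>. If \<open>\<psi>\<close> does not become small, it is bounded below by a small positive constant, to which
  the same argument applies with \<open>\<epsilon> = 1\<close>.
\<close>

subsection \<open>Distance to the nearest integer\<close>

abbreviation int_dist :: "real \<Rightarrow> real" where
  "int_dist x \<equiv> infdist x \<int>"

lemma int_dist_eq_abs_round: "int_dist x = \<bar>x - of_int (round x)\<bar>"
proof (rule antisym)
  show "int_dist x \<le> \<bar>x - of_int (round x)\<bar>"
    by (metis Ints_of_int dist_real_def infdist_le)
  show "\<bar>x - of_int (round x)\<bar> \<le> int_dist x"
    using Ints_0 by (subst infdist_notempty)
      (auto simp: dist_real_def round_diff_minimal elim!: Ints_cases intro!: cINF_greatest)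
qed

lemma int_dist_le_half: "int_dist x \<le> 1 / 2"
  using of_int_round_abs_le[of x] by (simp add: int_dist_eq_abs_round abs_minus_commute)

lemma int_dist_add_of_int: "int_dist (x + of_int k) = int_dist x"
proof -
  have shift_le: "int_dist (y + of_int j) \<le> int_dist y" for y and j :: int
    by (rule infdist_le2[of "of_int (round y + j)"])
      (auto simp: int_dist_eq_abs_round dist_real_def)
  show ?thesis
    using shift_le[of x k] shift_le[of "x + of_int k" "- k"] by simp
qed

lemma int_dist_eq_abs:
  assumes "\<bar>x\<bar> \<le> 1 / 2"
  shows "int_dist x = \<bar>x\<bar>"
proof (rule antisym)
  show "int_dist x \<le> \<bar>x\<bar>"
    using round_diff_minimal[of x 0] by (simp add: int_dist_eq_abs_round)
  show "\<bar>x\<bar> \<le> int_dist x"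
  proof (cases "round x = 0")
    case False
    then have "1 \<le> \<bar>real_of_int (round x)\<bar>"
      by linarith
    then show ?thesis
      using assms by (simp add: int_dist_eq_abs_round)
  qed (simp add: int_dist_eq_abs_round)
qed

lemma borel_measurable_int_dist [measurable]: "int_dist \<in> borel_measurable borel"
  by (intro borel_measurable_continuous_onI continuous_intros)

lemma int_dist_mult_add_le:
  "int_dist (real m * \<alpha> + x) \<le> int_dist (real m * \<alpha>' + x) + real m * int_dist (\<alpha> - \<alpha>')"
proof -
  define k where "k = round (\<alpha> - \<alpha>')"
  have "int_dist (real m * \<alpha> + x) = int_dist (real m * (\<alpha> - of_int k) + x)"
    using int_dist_add_of_int[of "real m * (\<alpha> - of_int k) + x" "int m * k"]
    by (simp add: algebra_simps)
  also have "\<dots> \<le> int_dist (real m * \<alpha>' + x) + \<bar>real m * (\<alpha> - \<alpha>' - of_int k)\<bar>"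
    using infdist_triangle[of "real m * (\<alpha> - of_int k) + x" \<int> "real m * \<alpha>' + x"]
    by (simp add: dist_real_def algebra_simps)
  also have "\<bar>real m * (\<alpha> - \<alpha>' - of_int k)\<bar> = real m * int_dist (\<alpha> - \<alpha>')"
    by (simp add: abs_mult int_dist_eq_abs_round k_def)
  finally show ?thesis .
qed

lemma exists_grid_point_int_dist_le:
  assumes "K \<ge> 1"
  shows "\<exists>i<K. int_dist (\<alpha> - real i / real K) \<le> 1 / real K"
proof (intro exI conjI)
  define i where "i = nat \<lfloor>real K * frac \<alpha>\<rfloor>"
  have i: "real i \<le> real K * frac \<alpha>" "real K * frac \<alpha> < real i + 1"
    by (simp_all add: i_def of_nat_nat)
  show "i < K"
    using le_less_trans[OF i(1), of "real K"] frac_lt_1[of \<alpha>] assms by simp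
  have "int_dist (\<alpha> - real i / real K) = int_dist (frac \<alpha> - real i / real K)"
    using int_dist_add_of_int[of "frac \<alpha> - real i / real K" "\<lfloor>\<alpha>\<rfloor>"] by (simp add: frac_def)
  also have "\<dots> \<le> \<bar>frac \<alpha> - real i / real K\<bar>"
    using infdist_le[of 0 \<int> "frac \<alpha> - real i / real K"] by simp
  also have "\<dots> \<le> 1 / real K"
  proof -
    have "real i / real K \<le> frac \<alpha>" "frac \<alpha> \<le> real i / real K + 1 / real K"
      using i assms by (simp_all add: field_simps)
    then show ?thesis
      by simp
  qed
  finally show "int_dist (\<alpha> - real i / real K) \<le> 1 / real K" .
qed

lemma infinite_approximations_of_INFM_int_dist:
  fixes \<alpha> \<beta> :: real and g d \<psi> :: "nat \<Rightarrow> real"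
  assumes "\<exists>\<^sub>\<infinity>n. int_dist (real n * \<alpha> + g n) * int_dist (real n * \<beta> + d n) \<le> \<psi> n"
  shows "infinite {(n :: nat, a :: int, b :: int). n \<ge> 1 \<and>
    \<bar>\<alpha> + g n / real n - real_of_int a / real n\<bar> * \<bar>\<beta> + d n / real n - real_of_int b / real n\<bar>
      \<le> \<psi> n / (real n)\<^sup>2}" (is "infinite ?T")
proof
  assume "finite ?T"
  have "n \<in> fst ` ?T"
    if n: "n \<ge> 1" and hit: "int_dist (real n * \<alpha> + g n) * int_dist (real n * \<beta> + d n) \<le> \<psi> n" for n
  proof -
    have "\<bar>x + y / real n - of_int (round (real n * x + y)) / real n\<bar> =
        int_dist (real n * x + y) / real n" for x y
    proof -
      have "x + y / real n - of_int (round (real n * x + y)) / real n =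
          (real n * x + y - of_int (round (real n * x + y))) / real n"
        using n by (simp add: field_simps)
      then show ?thesis
        by (simp add: int_dist_eq_abs_round)
    qed
    then have "(n, round (real n * \<alpha> + g n), round (real n * \<beta> + d n)) \<in> ?T"
      using n divide_right_mono[OF hit, of "(real n)\<^sup>2"] by (simp add: power2_eq_square)
    then show ?thesis
      by force
  qed
  moreover have "\<exists>\<^sub>\<infinity>n. int_dist (real n * \<alpha> + g n) * int_dist (real n * \<beta> + d n) \<le> \<psi> n \<and> n \<ge> 1"
    using assms by (rule frequently_eventually_frequently)
      (simp add: cofinite_eq_sequentially eventually_ge_at_top)
  ultimately have "\<exists>\<^sub>\<infinity>n. n \<in> fst ` ?T"
    by (auto elim!: frequently_elim1)
  with \<open>finite ?T\<close> show False
    by (simp add: INFM_iff_infinite)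
qed

subsection \<open>Uniform distributions\<close>

lemma emeasure_lborel_vimage_plus:
  fixes c :: "'a :: euclidean_space"
  assumes "A \<in> sets borel"
  shows "emeasure lborel ((+) c -` A) = emeasure lborel A"
proof -
  have "emeasure lborel A = emeasure (distr lborel borel ((+) c)) A"
    by (simp add: lborel_distr_plus)
  also have "\<dots> = emeasure lborel ((+) c -` A)"
    using assms by (subst emeasure_distr) auto
  finally show ?thesis ..
qed

lemma emeasure_lborel_periodic_Int_atLeastLessThan:
  fixes A :: "real set"
  assumes [measurable]: "A \<in> sets borel" and periodic: "\<And>x. p + x \<in> A \<longleftrightarrow> x \<in> A"
    and "a \<le> c" "c \<le> a + p"
  shows "emeasure lborel ({c..<c + p} \<inter> A) = emeasure lborel ({a..<a + p} \<inter> A)"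
proof -
  have "emeasure lborel ({c..<c + p} \<inter> A) =
      emeasure lborel ({c..<a + p} \<inter> A) + emeasure lborel ({a + p..<c + p} \<inter> A)"
    using assms by (subst plus_emeasure) (auto intro!: arg_cong[where f = "emeasure lborel"])
  also have "emeasure lborel ({a + p..<c + p} \<inter> A) =
      emeasure lborel ((+) p -` ({a + p..<c + p} \<inter> A))"
    by (rule emeasure_lborel_vimage_plus[symmetric]) measurable
  also have "(+) p -` ({a + p..<c + p} \<inter> A) = {a..<c} \<inter> A"
    using periodic by auto
  also have "emeasure lborel ({c..<a + p} \<inter> A) + emeasure lborel ({a..<c} \<inter> A) =
      emeasure lborel ({a..<a + p} \<inter> A)"
    using assms by (subst plus_emeasure) (auto intro!: arg_cong[where f = "emeasure lborel"])
  finally show ?thesis .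
qed

lemma emeasure_uniform_int_dist_le:
  assumes "0 \<le> s" "s \<le> 1 / 2"
  shows "emeasure (uniform_measure lborel {0..<1}) {x. int_dist (u + x) \<le> s} = ennreal (2 * s)"
proof -
  define v where "v = u - of_int (round u)"
  have v: "- 1 / 2 \<le> v" "v \<le> - 1 / 2 + 1"
    using of_int_round_abs_le[of u] unfolding v_def by linarith+
  let ?P = "{x. int_dist x \<le> s}"
  have "{x. int_dist (u + x) \<le> s} = {x. int_dist (v + x) \<le> s}"
    using int_dist_add_of_int[of "v + x" "round u" for x] by (simp add: v_def algebra_simps)
  then have "emeasure (uniform_measure lborel {0..<1}) {x. int_dist (u + x) \<le> s} =
      emeasure lborel ({0..<1} \<inter> {x. int_dist (v + x) \<le> s})"
    by (simp add: divide_ennreal_def)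
  also have "{0..<1} \<inter> {x. int_dist (v + x) \<le> s} = (+) v -` ({v..<v + 1} \<inter> ?P)"
    by auto
  also have "emeasure lborel \<dots> = emeasure lborel ({v..<v + 1} \<inter> ?P)"
    by (rule emeasure_lborel_vimage_plus) measurable
  also have "\<dots> = emeasure lborel ({- 1 / 2..<- 1 / 2 + 1} \<inter> ?P)"
    using int_dist_add_of_int[of _ 1]
    by (intro emeasure_lborel_periodic_Int_atLeastLessThan v) (simp_all add: add.commute)
  also have "{- 1 / 2..<- 1 / 2 + 1} \<inter> ?P = (if s = 1 / 2 then {- 1 / 2..<1 / 2} else {- s..s})"
    using assms by (auto simp: int_dist_eq_abs)
  also have "emeasure lborel \<dots> = ennreal (2 * s)"
    using assms by auto
  finally show ?thesis .
qed

lemma (in prob_space) distr_eq_uniform_measureI: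
  fixes X :: "'a \<Rightarrow> real"
  assumes "X \<in> borel_measurable M" "a < b"
    and "\<And>t. a \<le> t \<Longrightarrow> t \<le> b \<Longrightarrow> prob {\<omega> \<in> space M. X \<omega> \<le> t} = (t - a) / (b - a)"
  shows "distr M borel X = uniform_measure lborel {a..b}"
proof -
  have "distributed M lborel X (\<lambda>x. indicator {a..b} x / measure lborel {a..b})"
    using assms by (rule uniform_distrI_borel_atLeastAtMost)
  then have "distr M lborel X =
      density lborel (\<lambda>x. ennreal (indicator {a..b} x / measure lborel {a..b}))"
    by (rule distributed_distr_eq_density)
  also have "\<dots> = uniform_measure lborel {a..b}"
    using \<open>a < b\<close> by (simp add: uniform_measure_def divide_ennreal flip: ennreal_indicator)
  finally show ?thesis
    by (simp cong: distr_cong)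
qed

lemma (in prob_space) distr_uniform_int_dist:
  assumes [measurable]: "X \<in> borel_measurable M"
    and unif: "distr M borel X = uniform_measure lborel {0..<1}"
  shows "distr M borel (\<lambda>\<omega>. int_dist (u + X \<omega>)) = uniform_measure lborel {0..1 / 2}"
proof -
  let ?Y = "\<lambda>\<omega>. int_dist (u + X \<omega>)"
  have "prob {\<omega> \<in> space M. ?Y \<omega> \<le> s} = (s - 0) / (1 / 2 - 0)" if s: "0 \<le> s" "s \<le> 1 / 2" for s
  proof -
    have "emeasure M {\<omega> \<in> space M. ?Y \<omega> \<le> s} = emeasure (distr M borel X) {x. int_dist (u + x) \<le> s}"
      by (subst emeasure_distr) (auto intro!: arg_cong[where f = "emeasure M"])
    also have "\<dots> = ennreal (2 * s)"
      unfolding unif by (rule emeasure_uniform_int_dist_le[OF s])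
    finally show ?thesis
      using s by (simp add: emeasure_eq_measure)
  qed
  then show ?thesis
    by (intro distr_eq_uniform_measureI) auto
qed

lemma sets_borel_pair_mult_le:
  "{(x :: real, y). x * y \<le> t} \<in> sets (borel \<Otimes>\<^sub>M borel)"
proof -
  have "{p \<in> space (borel \<Otimes>\<^sub>M borel). fst p * snd p \<le> t} \<in> sets (borel \<Otimes>\<^sub>M borel)"
    by measurable
  then show ?thesis
    by (simp add: space_pair_measure case_prod_beta')
qed

lemma emeasure_uniform_section_mult_le:
  fixes b c x :: real
  assumes "0 < b" "0 < c"
  shows "emeasure (uniform_measure lborel {0..b}) {y. x * y \<le> c * b} * indicator {0..a} x =
    indicator ({0..<c} \<inter> {0..a}) x + ennreal (c / x) * indicator {c..a} x"
proof -
  consider (outside) "x \<notin> {0..a}" | (full) "x \<in> {0..a}" "x < c" | (partial) "x \<in> {0..a}" "c \<le> x"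
    by fastforce
  then show ?thesis
  proof cases
    case outside
    then show ?thesis
      using assms by auto
  next
    case full
    have "x * y \<le> c * b" if "y \<in> {0..b}" for y
      using that full assms by (intro mult_mono) auto
    then have "{0..b} \<inter> {y. x * y \<le> c * b} = {0..b}"
      by blast
    then show ?thesis
      using full assms by (simp add: divide_ennreal)
  next
    case partial
    then have "c * b / x \<le> b"
      using assms mult_right_mono[of c x b] by (simp add: divide_le_eq mult.commute)
    moreover have "{y. x * y \<le> c * b} = {..c * b / x}"
      using partial assms by (auto simp: pos_le_divide_eq mult.commute)
    ultimately have "{0..b} \<inter> {y. x * y \<le> c * b} = {0..c * b / x}"
      by auto
    then show ?thesis
      using partial assms by (simp add: divide_ennreal)
  qed
qed

lemma emeasure_uniform_pair_mult_le:
  fixes a b t :: real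
  assumes "0 < a" "0 < b" "0 < t" "t \<le> a * b"
  shows "emeasure (uniform_measure lborel {0..a} \<Otimes>\<^sub>M uniform_measure lborel {0..b})
      {(x, y). x * y \<le> t} = ennreal (t / (a * b) * (1 + ln (a * b / t)))"
proof -
  let ?U = "uniform_measure lborel {0..a}" and ?V = "uniform_measure lborel {0..b}"
  let ?H = "{(x, y). x * y \<le> t}"
  interpret V: prob_space ?V
    using \<open>0 < b\<close> by (intro prob_space_uniform_measure) auto
  define c where "c = t / b"
  have c: "0 < c" "c \<le> a" "t = c * b"
    using assms by (simp_all add: c_def divide_le_eq)
  have H: "?H \<in> sets (?U \<Otimes>\<^sub>M ?V)"
    using sets_borel_pair_mult_le[of t] by (simp cong: sets_pair_measure_cong)
  have "emeasure (?U \<Otimes>\<^sub>M ?V) ?H = (\<integral>\<^sup>+x. emeasure ?V (Pair x -` ?H) \<partial>?U)"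
    by (rule V.emeasure_pair_measure_alt[OF H])
  also have "\<dots> = (\<integral>\<^sup>+x. emeasure ?V (Pair x -` ?H) * indicator {0..a} x \<partial>lborel) / ennreal a"
    using \<open>0 < a\<close> V.measurable_emeasure_Pair[OF H] by (subst nn_integral_uniform_measure) auto
  also have "(\<integral>\<^sup>+x. emeasure ?V (Pair x -` ?H) * indicator {0..a} x \<partial>lborel) =
      (\<integral>\<^sup>+x. indicator {0..<c} x + ennreal (c / x) * indicator {c..a} x \<partial>lborel)"
  proof -
    have "{0..<c} \<inter> {0..a} = {0..<c}"
      using c by auto
    then show ?thesis
      using emeasure_uniform_section_mult_le[OF \<open>0 < b\<close> \<open>0 < c\<close>, of _ a]
      by (simp add: vimage_def c(3))
  qed
  also have "\<dots> = ennreal c + ennreal (c * ln a - c * ln c)"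
  proof -
    have "(\<integral>\<^sup>+x. ennreal (c / x) * indicator {c..a} x \<partial>lborel) = ennreal (c * ln a - c * ln c)"
      using c by (intro nn_integral_FTC_Icc) (auto intro!: derivative_eq_intros)
    then show ?thesis
      using c by (subst nn_integral_add) auto
  qed
  also have "\<dots> / ennreal a = ennreal ((c + (c * ln a - c * ln c)) / a)"
    using c \<open>0 < a\<close> by (simp add: divide_ennreal flip: ennreal_plus)
  also have "(c + (c * ln a - c * ln c)) / a = t / (a * b) * (1 + ln (a * b / t))"
    using assms by (simp add: c_def ln_div ln_mult field_simps)
  finally show ?thesis .
qed

lemma (in prob_space) prob_uniform_mult_le:
  assumes indep: "indep_var borel X borel Y"
    and X: "distr M borel X = uniform_measure lborel {0..a}"
    and Y: "distr M borel Y = uniform_measure lborel {0..b}"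
    and t: "0 < a" "0 < b" "0 < t" "t \<le> a * b"
  shows "prob {\<omega> \<in> space M. X \<omega> * Y \<omega> \<le> t} = t / (a * b) * (1 + ln (a * b / t))"
proof -
  have [measurable]: "X \<in> borel_measurable M" "Y \<in> borel_measurable M"
    using indep_var_rv1[OF indep] indep_var_rv2[OF indep] .
  have "emeasure M {\<omega> \<in> space M. X \<omega> * Y \<omega> \<le> t} =
      emeasure (distr M (borel \<Otimes>\<^sub>M borel) (\<lambda>\<omega>. (X \<omega>, Y \<omega>))) {(x, y). x * y \<le> t}"
    using sets_borel_pair_mult_le[of t]
    by (subst emeasure_distr) (auto intro!: arg_cong[where f = "emeasure M"])
  also have "distr M (borel \<Otimes>\<^sub>M borel) (\<lambda>\<omega>. (X \<omega>, Y \<omega>)) =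
      uniform_measure lborel {0..a} \<Otimes>\<^sub>M uniform_measure lborel {0..b}"
    using indep X Y by (simp add: indep_var_distribution_eq)
  finally show ?thesis
    using t by (simp add: emeasure_uniform_pair_mult_le emeasure_eq_measure)
qed

subsection \<open>Independence and almost sure events\<close>

lemma (in prob_space) indep_vars_mult_case_sum:
  fixes X :: "'i \<Rightarrow> 'a \<Rightarrow> real"
  assumes indep: "indep_vars (\<lambda>_. borel) (case_sum X Y) (I <+> I)"
  shows "indep_vars (\<lambda>_. borel) (\<lambda>i \<omega>. X i \<omega> * Y i \<omega>) I"
proof -
  let ?K = "\<lambda>i. {Inl i, Inr i}" and ?mult = "\<lambda>i f. f (Inl i) * f (Inr i)"
  have "indep_vars (\<lambda>i. PiM (?K i) (\<lambda>_. borel)) (\<lambda>i \<omega>. restrict (\<lambda>k. case_sum X Y k \<omega>) (?K i)) I"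
    by (rule indep_vars_restrict[OF indep]) (auto simp: disjoint_family_on_def)
  then have "indep_vars (\<lambda>_. borel) (\<lambda>i \<omega>. ?mult i (restrict (\<lambda>k. case_sum X Y k \<omega>) (?K i))) I"
    by (rule indep_vars_compose2)
      (intro borel_measurable_times measurable_component_singleton; simp)
  then show ?thesis
    by simp
qed

lemma (in prob_space) indep_var_of_indep_vars:
  assumes indep: "indep_vars M' X I" and "i \<in> I" "j \<in> I" "i \<noteq> j"
  shows "indep_var (M' i) (X i) (M' j) (X j)"
proof -
  have "indep_var (M' i) ((\<lambda>f. f i) \<circ> (\<lambda>\<omega>. restrict (\<lambda>k. X k \<omega>) {i}))
      (M' j) ((\<lambda>f. f j) \<circ> (\<lambda>\<omega>. restrict (\<lambda>k. X k \<omega>) {j}))"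
    using assms by (intro indep_var_compose[OF indep_var_restrict[OF indep]]) auto
  then show ?thesis
    by (simp add: comp_def)
qed

lemma (in prob_space) prob_Ball_gt_le_exp:
  fixes X :: "'i \<Rightarrow> 'a \<Rightarrow> real"
  assumes indep: "indep_vars (\<lambda>_. borel) X I" and "finite I"
  shows "prob {\<omega> \<in> space M. \<forall>i\<in>I. t i < X i \<omega>} \<le> exp (- (\<Sum>i\<in>I. prob {\<omega> \<in> space M. X i \<omega> \<le> t i}))"
proof (cases "I = {}")
  case False
  have rv: "X i \<in> borel_measurable M" if "i \<in> I" for i
    using indep that by (auto simp: indep_vars_def)
  have prob_gt_le: "prob (X i -` {t i<..} \<inter> space M) \<le> exp (- prob {\<omega> \<in> space M. X i \<omega> \<le> t i})"
    if "i \<in> I" for i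
  proof -
    note rv[OF that, measurable]
    have "X i -` {t i<..} \<inter> space M = space M - {\<omega> \<in> space M. X i \<omega> \<le> t i}"
      by auto
    then have "prob (X i -` {t i<..} \<inter> space M) = 1 + - prob {\<omega> \<in> space M. X i \<omega> \<le> t i}"
      by (simp add: prob_compl)
    also have "\<dots> \<le> exp (- prob {\<omega> \<in> space M. X i \<omega> \<le> t i})"
      by (rule exp_ge_add_one_self)
    finally show ?thesis .
  qed
  have "{\<omega> \<in> space M. \<forall>i\<in>I. t i < X i \<omega>} = (\<Inter>i\<in>I. X i -` {t i<..} \<inter> space M)"
    using False by auto
  also have "prob \<dots> = (\<Prod>i\<in>I. prob (X i -` {t i<..} \<inter> space M))"
    using False \<open>finite I\<close> by (intro indep_varsD_finite[OF indep]) auto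
  also have "\<dots> \<le> (\<Prod>i\<in>I. exp (- prob {\<omega> \<in> space M. X i \<omega> \<le> t i}))"
    by (intro prod_mono conjI measure_nonneg prob_gt_le)
  also have "\<dots> = exp (- (\<Sum>i\<in>I. prob {\<omega> \<in> space M. X i \<omega> \<le> t i}))"
    using \<open>finite I\<close> by (simp add: exp_sum flip: sum_negf)
  finally show ?thesis .
qed simp

lemma (in finite_measure) AE_I_small_cover:
  assumes "\<And>e. 0 < e \<Longrightarrow> \<exists>A\<in>sets M. {x \<in> space M. \<not> P x} \<subseteq> A \<and> measure M A \<le> e"
  shows "AE x in M. P x"
proof -
  have "\<exists>A\<in>sets M. {x \<in> space M. \<not> P x} \<subseteq> A \<and> measure M A \<le> 1 / Suc k" for k
    using assms by simp
  then obtain A where A: "\<And>k. A k \<in> sets M" "\<And>k. {x \<in> space M. \<not> P x} \<subseteq> A k"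
    "\<And>k. measure M (A k) \<le> 1 / Suc k"
    by metis
  have "measure M (\<Inter>k. A k) \<le> 1 / Suc k" for k
    using finite_measure_mono[of "\<Inter>k. A k" "A k"] A(1) A(3)[of k] by force
  then have "measure M (\<Inter>k. A k) \<le> 0"
    by (intro LIMSEQ_le_const[OF LIMSEQ_Suc[OF lim_1_over_n]]) auto
  then have "(\<Inter>k. A k) \<in> null_sets M"
    using A(1) measure_le_0_iff by (auto simp: null_sets_def emeasure_eq_measure)
  then show ?thesis
    by (rule AE_I') (use A(2) in blast)
qed

lemma INFM_gt_of_limsup_eq_PInfty:
  assumes "limsup (\<lambda>n. ereal (f n)) = \<infinity>"
  shows "\<exists>\<^sub>\<infinity>n. B < f n"
proof (rule ccontr)
  assume "\<not> (\<exists>\<^sub>\<infinity>n. B < f n)"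
  then have "\<forall>\<^sub>F n in sequentially. ereal (f n) \<le> ereal B"
    by (simp add: not_frequently cofinite_eq_sequentially not_less)
  then have "limsup (\<lambda>n. ereal (f n)) \<le> ereal B"
    by (rule Limsup_bounded)
  with assms show False
    by simp
qed

subsection \<open>The function \<open>x ln (1/x)\<close>\<close>

definition entropy_term :: "real \<Rightarrow> real" where
  "entropy_term x = x * ln (1 / x)"

lemma entropy_term_0 [simp]: "entropy_term 0 = 0"
  by (simp add: entropy_term_def)

lemma entropy_term_nonneg:
  assumes "0 \<le> x" "x \<le> 1"
  shows "0 \<le> entropy_term x"
  using assms by (cases "x = 0") (simp_all add: entropy_term_def)

lemma entropy_term_mult:
  assumes "0 < c" "0 \<le> x"
  shows "entropy_term (c * x) = c * entropy_term x - c * x * ln c"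
  using assms by (cases "x = 0") (simp_all add: entropy_term_def ln_div ln_mult algebra_simps)

lemma entropy_term_add_le:
  assumes "0 \<le> x" "0 \<le> y"
  shows "entropy_term (x + y) \<le> entropy_term x + entropy_term y"
proof (cases "x = 0 \<or> y = 0")
  case False
  then have "x * ln (1 / (x + y)) \<le> x * ln (1 / x)" "y * ln (1 / (x + y)) \<le> y * ln (1 / y)"
    using assms by (simp_all add: frac_le)
  then show ?thesis
    by (simp add: entropy_term_def distrib_right)
qed auto

lemma entropy_term_le_of_le:
  assumes "0 \<le> x" "x \<le> y" "y \<le> 1"
  shows "entropy_term x \<le> y + entropy_term y"
proof (cases "x = 0")
  case False
  with assms have pos: "0 < x" "0 < y"
    by auto
  then have "entropy_term x = x * ln (y / x) + x * ln (1 / y)"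
    by (simp add: entropy_term_def ln_div algebra_simps)
  also have "x * ln (y / x) \<le> x * (y / x - 1)"
    using pos by (intro mult_left_mono ln_le_minus_one) auto
  also have "\<dots> \<le> y"
    using pos by (simp add: field_simps)
  also have "x * ln (1 / y) \<le> entropy_term y"
    unfolding entropy_term_def using assms pos by (intro mult_right_mono) auto
  finally show ?thesis
    by simp
qed (use assms entropy_term_nonneg[of y] in auto)

lemma entropy_term_truncate_le:
  assumes "0 \<le> t" "0 \<le> \<kappa>" "\<kappa> \<le> 1" "1 \<le> c"
  shows "entropy_term (c * t) \<le> entropy_term (c * max 0 (t - \<kappa>)) + c * (\<kappa> + entropy_term \<kappa>)"
proof -
  have "entropy_term (c * t) = entropy_term (c * max 0 (t - \<kappa>) + c * min t \<kappa>)"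
    using assms by (simp add: max_def min_def right_diff_distrib)
  also have "\<dots> \<le> entropy_term (c * max 0 (t - \<kappa>)) + entropy_term (c * min t \<kappa>)"
    using assms by (intro entropy_term_add_le mult_nonneg_nonneg) auto
  also have "entropy_term (c * min t \<kappa>) \<le> c * entropy_term (min t \<kappa>)"
    using assms by (simp add: entropy_term_mult)
  also have "\<dots> \<le> c * (\<kappa> + entropy_term \<kappa>)"
    using assms by (intro mult_left_mono entropy_term_le_of_le) auto
  finally show ?thesis
    by simp
qed

lemma entropy_term_mult_ge:
  assumes "0 < c" "0 < \<epsilon>" "0 \<le> t" "t \<le> c powr (- c / \<epsilon>)"
  shows "(c - \<epsilon>) * entropy_term t \<le> entropy_term (c * t)"
proof (cases "t = 0")
  case False
  with assms have "0 < t"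
    by simp
  have "ln t \<le> - c / \<epsilon> * ln c"
    using ln_mono[OF assms(4) \<open>0 < t\<close>] assms(1) by (simp add: ln_powr)
  then have "c * ln c \<le> \<epsilon> * ln (1 / t)"
    using \<open>0 < \<epsilon>\<close> \<open>0 < t\<close> by (simp add: ln_div field_simps)
  then have "c * t * ln c \<le> \<epsilon> * entropy_term t"
    using mult_left_mono[of "c * ln c" "\<epsilon> * ln (1 / t)" t] \<open>0 < t\<close>
    by (simp add: entropy_term_def mult.left_commute mult.assoc)
  then show ?thesis
    using assms by (simp add: entropy_term_mult left_diff_distrib)
qed simp

lemma sum_entropy_term_truncate_le:
  fixes f :: "'i \<Rightarrow> real"
  assumes "1 \<le> c" "0 < \<epsilon>" "0 \<le> \<kappa>" "\<kappa> \<le> 1"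
    and f: "\<And>i. i \<in> I \<Longrightarrow> 0 \<le> f i \<and> f i \<le> c powr (- c / \<epsilon>)"
  shows "(c - \<epsilon>) * (\<Sum>i\<in>I. entropy_term (f i)) \<le>
    (\<Sum>i\<in>I. entropy_term (c * max 0 (f i - \<kappa>))) + real (card I) * (c * (\<kappa> + entropy_term \<kappa>))"
proof -
  have "(c - \<epsilon>) * entropy_term (f i) \<le>
      entropy_term (c * max 0 (f i - \<kappa>)) + c * (\<kappa> + entropy_term \<kappa>)" if "i \<in> I" for i
    using entropy_term_mult_ge[of c \<epsilon> "f i"] entropy_term_truncate_le[of "f i" \<kappa> c]
      f[OF that] assms(1-4) by linarith
  then have "(c - \<epsilon>) * (\<Sum>i\<in>I. entropy_term (f i)) \<le>
      (\<Sum>i\<in>I. entropy_term (c * max 0 (f i - \<kappa>)) + c * (\<kappa> + entropy_term \<kappa>))"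
    unfolding sum_distrib_left by (rule sum_mono)
  then show ?thesis
    by (simp add: sum.distrib)
qed

lemma tendsto_mult_powr_entropy_term:
  fixes s :: real
  assumes "1 < s"
  shows "(\<lambda>n. real n * (real n powr - s + entropy_term (real n powr - s))) \<longlonglongrightarrow> 0"
  unfolding entropy_term_def using assms by real_asymp

text \<open>
  Up to \<open>1/4\<close> the distribution function of the product of distances has the logarithmic form, and
  \<open>4 powr (- 4 / \<epsilon>)\<close> is the positive solution \<open>t\<close> of \<open>\<eta> (4 t) = (4 - \<epsilon>) \<eta> t\<close>.
\<close>
definition smallness_bound :: "real \<Rightarrow> real" where
  "smallness_bound \<epsilon> = min (1 / 4) (4 powr (- 4 / \<epsilon>))"

definition entropy_growth :: "real \<Rightarrow> (nat \<Rightarrow> real) \<Rightarrow> nat \<Rightarrow> real" where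
  "entropy_growth \<epsilon> \<psi> n =
    1 / real n powr (4 + \<epsilon>) * exp ((4 - \<epsilon>) * (\<Sum>m = 1..n. entropy_term (\<psi> m)))"

subsection \<open>Hits and misses of uniformly shifted lattices\<close>

locale uniform_shifts = prob_space M for M :: "'a measure" +
  fixes \<gamma> \<delta> :: "nat \<Rightarrow> 'a \<Rightarrow> real"
  assumes indep_shifts: "indep_vars (\<lambda>_. borel) (case_sum \<gamma> \<delta>) ({1..} <+> {1..})"
    and distr_\<gamma>: "\<And>n. n \<ge> 1 \<Longrightarrow> distr M borel (\<gamma> n) = uniform_measure lborel {0..<1}"
    and distr_\<delta>: "\<And>n. n \<ge> 1 \<Longrightarrow> distr M borel (\<delta> n) = uniform_measure lborel {0..<1}"
begin

definition dist_prod :: "real \<Rightarrow> real \<Rightarrow> nat \<Rightarrow> 'a \<Rightarrow> real" where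
  "dist_prod \<alpha> \<beta> m \<omega> = int_dist (real m * \<alpha> + \<gamma> m \<omega>) * int_dist (real m * \<beta> + \<delta> m \<omega>)"

definition missed_at :: "real \<Rightarrow> real \<Rightarrow> (nat \<Rightarrow> real) \<Rightarrow> nat set \<Rightarrow> 'a set" where
  "missed_at \<alpha> \<beta> \<psi> I = {\<omega> \<in> space M. \<forall>m\<in>I. \<psi> m < dist_prod \<alpha> \<beta> m \<omega>}"

definition missed :: "(nat \<Rightarrow> real) \<Rightarrow> nat set \<Rightarrow> 'a set" where
  "missed \<psi> I = (\<Union>\<alpha> \<beta>. missed_at \<alpha> \<beta> \<psi> I)"

lemma indep_vars_int_dist_shifts:
  "indep_vars (\<lambda>_. borel)
    (case_sum (\<lambda>m \<omega>. int_dist (real m * \<alpha> + \<gamma> m \<omega>)) (\<lambda>m \<omega>. int_dist (real m * \<beta> + \<delta> m \<omega>)))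
    ({1..} <+> {1..})"
proof -
  let ?f = "case_sum (\<lambda>m x. int_dist (real m * \<alpha> + x)) (\<lambda>m x. int_dist (real m * \<beta> + x))"
  have "?f k \<in> borel_measurable borel" for k
    by (cases k) simp_all
  then have "indep_vars (\<lambda>_. borel) (\<lambda>k \<omega>. ?f k (case_sum \<gamma> \<delta> k \<omega>)) ({1..} <+> {1..})"
    by (intro indep_vars_compose2[OF indep_shifts])
  moreover have "(\<lambda>k \<omega>. ?f k (case_sum \<gamma> \<delta> k \<omega>)) =
      case_sum (\<lambda>m \<omega>. int_dist (real m * \<alpha> + \<gamma> m \<omega>)) (\<lambda>m \<omega>. int_dist (real m * \<beta> + \<delta> m \<omega>))"
    by (auto simp: fun_eq_iff split: sum.split)
  ultimately show ?thesis
    by simp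
qed

lemma indep_vars_dist_prod: "indep_vars (\<lambda>_. borel) (dist_prod \<alpha> \<beta>) {1..}"
  using indep_vars_mult_case_sum[OF indep_vars_int_dist_shifts[of \<alpha> \<beta>]]
  by (simp add: dist_prod_def[abs_def])

lemma borel_measurable_dist_prod [measurable]:
  "m \<ge> 1 \<Longrightarrow> dist_prod \<alpha> \<beta> m \<in> borel_measurable M"
  using indep_vars_dist_prod[of \<alpha> \<beta>] by (auto simp: indep_vars_def)

lemma distr_int_dist_shift:
  assumes "m \<ge> 1"
  shows "distr M borel (\<lambda>\<omega>. int_dist (real m * \<alpha> + \<gamma> m \<omega>)) = uniform_measure lborel {0..1 / 2}"
    and "distr M borel (\<lambda>\<omega>. int_dist (real m * \<alpha> + \<delta> m \<omega>)) = uniform_measure lborel {0..1 / 2}"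
proof -
  have "case_sum \<gamma> \<delta> k \<in> borel_measurable M" if "k \<in> {1..} <+> {1..}" for k
    using indep_shifts that by (auto simp: indep_vars_def)
  from this[of "Inl m"] this[of "Inr m"] assms
  have "\<gamma> m \<in> borel_measurable M" "\<delta> m \<in> borel_measurable M"
    by auto
  with assms show
    "distr M borel (\<lambda>\<omega>. int_dist (real m * \<alpha> + \<gamma> m \<omega>)) = uniform_measure lborel {0..1 / 2}"
    "distr M borel (\<lambda>\<omega>. int_dist (real m * \<alpha> + \<delta> m \<omega>)) = uniform_measure lborel {0..1 / 2}"
    by (simp_all add: distr_uniform_int_dist distr_\<gamma> distr_\<delta>)
qed

lemma prob_dist_prod_le_ge:
  assumes "m \<ge> 1" "t \<le> 1 / 4"
  shows "entropy_term (4 * max 0 t) \<le> prob {\<omega> \<in> space M. dist_prod \<alpha> \<beta> m \<omega> \<le> t}"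
proof (cases "0 < t")
  case True
  have "indep_var borel (\<lambda>\<omega>. int_dist (real m * \<alpha> + \<gamma> m \<omega>))
      borel (\<lambda>\<omega>. int_dist (real m * \<beta> + \<delta> m \<omega>))"
    using indep_var_of_indep_vars[OF indep_vars_int_dist_shifts, of "Inl m" "Inr m"] assms by auto
  from prob_uniform_mult_le[OF this distr_int_dist_shift[OF assms(1)], of t] assms(2) True
  have "prob {\<omega> \<in> space M. dist_prod \<alpha> \<beta> m \<omega> \<le> t} = 4 * t * (1 + ln (1 / (4 * t)))"
    by (simp add: dist_prod_def)
  then show ?thesis
    using True by (simp add: entropy_term_def distrib_left)
qed simp

lemma missed_at_in_events:
  assumes "finite I" "I \<subseteq> {1..}"
  shows "missed_at \<alpha> \<beta> t I \<in> events"
proof -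
  have [measurable]: "dist_prod \<alpha> \<beta> m \<in> borel_measurable M" if "m \<in> I" for m
    using that assms(2) by auto
  show ?thesis
    unfolding missed_at_def using assms(1) by measurable
qed

lemma prob_missed_at_le:
  assumes "finite I" "I \<subseteq> {1..}" "\<And>m. m \<in> I \<Longrightarrow> t m \<le> 1 / 4"
  shows "prob (missed_at \<alpha> \<beta> t I) \<le> exp (- (\<Sum>m\<in>I. entropy_term (4 * max 0 (t m))))"
proof -
  have "prob (missed_at \<alpha> \<beta> t I) \<le>
      exp (- (\<Sum>m\<in>I. prob {\<omega> \<in> space M. dist_prod \<alpha> \<beta> m \<omega> \<le> t m}))"
    unfolding missed_at_def
    using assms by (intro prob_Ball_gt_le_exp indep_vars_subset[OF indep_vars_dist_prod])
  also have "\<dots> \<le> exp (- (\<Sum>m\<in>I. entropy_term (4 * max 0 (t m))))"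
    using assms by (auto intro!: sum_mono prob_dist_prod_le_ge)
  finally show ?thesis .
qed

lemma dist_prod_perturb_le:
  "dist_prod \<alpha> \<beta> m \<omega> \<le> dist_prod \<alpha>' \<beta>' m \<omega> + real m * (int_dist (\<alpha> - \<alpha>') + int_dist (\<beta> - \<beta>')) / 2"
proof -
  let ?a = "int_dist (real m * \<alpha> + \<gamma> m \<omega>)" and ?a' = "int_dist (real m * \<alpha>' + \<gamma> m \<omega>)"
  let ?b = "int_dist (real m * \<beta> + \<delta> m \<omega>)" and ?b' = "int_dist (real m * \<beta>' + \<delta> m \<omega>)"
  have "?a * ?b - ?a' * ?b' = ?a * (?b - ?b') + ?b' * (?a - ?a')"
    by (simp add: algebra_simps)
  also have "\<dots> \<le> ?a * (real m * int_dist (\<beta> - \<beta>')) + ?b' * (real m * int_dist (\<alpha> - \<alpha>'))"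
    using int_dist_mult_add_le[of m \<alpha> "\<gamma> m \<omega>" \<alpha>'] int_dist_mult_add_le[of m \<beta> "\<delta> m \<omega>" \<beta>']
    by (intro add_mono mult_left_mono infdist_nonneg) auto
  also have "\<dots> \<le> 1 / 2 * (real m * int_dist (\<beta> - \<beta>')) + 1 / 2 * (real m * int_dist (\<alpha> - \<alpha>'))"
    by (intro add_mono mult_right_mono int_dist_le_half mult_nonneg_nonneg infdist_nonneg) auto
  finally show ?thesis
    by (simp add: dist_prod_def algebra_simps add_divide_distrib)
qed

lemma missed_subset_grid:
  assumes "K \<ge> 1" "I \<subseteq> {..n}" "real n \<le> real K * \<kappa>"
  shows "missed \<psi> I \<subseteq>
    (\<Union>(i, j)\<in>{..<K} \<times> {..<K}. missed_at (real i / real K) (real j / real K) (\<lambda>m. \<psi> m - \<kappa>) I)"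
proof
  fix \<omega> assume "\<omega> \<in> missed \<psi> I"
  then obtain \<alpha> \<beta> where \<omega>: "\<omega> \<in> space M" and miss: "\<And>m. m \<in> I \<Longrightarrow> \<psi> m < dist_prod \<alpha> \<beta> m \<omega>"
    by (auto simp: missed_def missed_at_def)
  obtain i j where "i < K" "j < K" and ij: "int_dist (\<alpha> - real i / real K) \<le> 1 / real K"
      "int_dist (\<beta> - real j / real K) \<le> 1 / real K"
    using exists_grid_point_int_dist_le[OF \<open>K \<ge> 1\<close>] by meson
  have "\<psi> m - \<kappa> < dist_prod (real i / real K) (real j / real K) m \<omega>" if "m \<in> I" for m
  proof -
    have "real m * (int_dist (\<alpha> - real i / real K) + int_dist (\<beta> - real j / real K)) / 2 \<le>
        real m * (1 / real K + 1 / real K) / 2"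
      using ij by (intro divide_right_mono mult_left_mono add_mono) auto
    also have "\<dots> \<le> real n / real K"
      using that assms by (auto intro!: divide_right_mono)
    also have "\<dots> \<le> \<kappa>"
      using assms by (simp add: divide_le_eq mult.commute)
    finally show ?thesis
      using dist_prod_perturb_le[of \<alpha> \<beta> m \<omega> "real i / real K" "real j / real K"] miss[OF that]
      by linarith
  qed
  with \<omega> have "\<omega> \<in> missed_at (real i / real K) (real j / real K) (\<lambda>m. \<psi> m - \<kappa>) I"
    by (simp add: missed_at_def)
  with \<open>i < K\<close> \<open>j < K\<close> show "\<omega> \<in> (\<Union>(i, j)\<in>{..<K} \<times> {..<K}.
      missed_at (real i / real K) (real j / real K) (\<lambda>m. \<psi> m - \<kappa>) I)"
    by blast
qed

lemma missed_cover_prob_le: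
  assumes "K \<ge> 1" "I \<subseteq> {1..n}" "real n \<le> real K * \<kappa>" "0 \<le> \<kappa>"
    and "\<And>m. m \<in> I \<Longrightarrow> \<psi> m \<le> 1 / 4"
  shows "\<exists>A\<in>events. missed \<psi> I \<subseteq> A \<and>
    prob A \<le> (real K)\<^sup>2 * exp (- (\<Sum>m\<in>I. entropy_term (4 * max 0 (\<psi> m - \<kappa>))))"
proof (intro bexI conjI)
  let ?E = "\<lambda>(i, j). missed_at (real i / real K) (real j / real K) (\<lambda>m. \<psi> m - \<kappa>) I"
  let ?grid = "{..<K} \<times> {..<K}"
  let ?bound = "exp (- (\<Sum>m\<in>I. entropy_term (4 * max 0 (\<psi> m - \<kappa>))))"
  have I: "finite I" "I \<subseteq> {1..}" "I \<subseteq> {..n}"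
    using assms(2) by (auto intro: finite_subset)
  show "missed \<psi> I \<subseteq> (\<Union>p\<in>?grid. ?E p)"
    by (rule missed_subset_grid[OF assms(1) I(3) assms(3)])
  have E_event: "?E p \<in> events" for p
    by (cases p) (simp add: missed_at_in_events[OF I(1,2)])
  then show "(\<Union>p\<in>?grid. ?E p) \<in> events"
    by auto
  have "\<psi> m - \<kappa> \<le> 1 / 4" if "m \<in> I" for m
    using assms(4,5) that by force
  then have E_prob: "prob (?E p) \<le> ?bound" for p
    by (cases p) (simp add: prob_missed_at_le[OF I(1,2)])
  have "prob (\<Union>p\<in>?grid. ?E p) \<le> (\<Sum>p\<in>?grid. prob (?E p))"
    using E_event by (intro finite_measure_subadditive_finite) auto
  also have "\<dots> \<le> (\<Sum>p\<in>?grid. ?bound)"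
    by (intro sum_mono E_prob)
  also have "\<dots> = (real K)\<^sup>2 * ?bound"
    by (simp add: power2_eq_square)
  finally show "prob (\<Union>p\<in>?grid. ?E p) \<le> (real K)\<^sup>2 * ?bound" .
qed

lemma missed_cover_prob_le_powr:
  assumes "0 < \<epsilon>" "1 \<le> N" "1 \<le> n"
    and small: "\<And>m. N \<le> m \<Longrightarrow> \<psi> m \<in> {0..smallness_bound \<epsilon>}"
  defines "\<kappa> \<equiv> real n powr - (1 + \<epsilon> / 2)"
  shows "\<exists>A\<in>events. missed \<psi> {N..n} \<subseteq> A \<and>
    prob A \<le> 4 * real n powr (4 + \<epsilon>) *
      exp (4 * (real n * (\<kappa> + entropy_term \<kappa>)) - (4 - \<epsilon>) * (\<Sum>m = N..n. entropy_term (\<psi> m)))"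
    (is "\<exists>A\<in>events. _ \<and> prob A \<le> _ * exp ?exponent")
proof -
  define side where "side = real n powr (2 + \<epsilon> / 2)"
  define K where "K = nat \<lceil>side\<rceil>"
  define loss where "loss = 4 * (\<kappa> + entropy_term \<kappa>)"
  let ?hits = "\<Sum>m = N..n. entropy_term (4 * max 0 (\<psi> m - \<kappa>))"
  have "1 \<le> side"
    using assms by (simp add: side_def ge_one_powr_ge_zero)
  have side: "side\<^sup>2 = real n powr (4 + \<epsilon>)" "side * \<kappa> = real n"
    using assms by (simp_all add: side_def \<kappa>_def power2_eq_square flip: powr_add)
  have K: "1 \<le> K" "side \<le> real K" "real K \<le> 2 * side"
    unfolding K_def using \<open>1 \<le> side\<close> by linarith+
  have \<kappa>: "0 \<le> \<kappa>" "\<kappa> \<le> 1"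
    using assms powr_mono[of "- (1 + \<epsilon> / 2)" 0 "real n"] by (simp_all add: \<kappa>_def)
  have "real n \<le> real K * \<kappa>"
    using mult_right_mono[OF K(2) \<kappa>(1)] by (simp add: side(2))
  then obtain A where A: "A \<in> events" "missed \<psi> {N..n} \<subseteq> A"
    "prob A \<le> (real K)\<^sup>2 * exp (- ?hits)"
    using missed_cover_prob_le[of K "{N..n}" n \<kappa> \<psi>] K(1) \<kappa>(1) \<open>1 \<le> N\<close> small
    by (auto simp: smallness_bound_def)
  have "(4 - \<epsilon>) * (\<Sum>m = N..n. entropy_term (\<psi> m)) \<le> ?hits + real (card {N..n}) * loss"
    unfolding loss_def using \<open>0 < \<epsilon>\<close> \<kappa> small
    by (intro sum_entropy_term_truncate_le) (auto simp: smallness_bound_def)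
  also have "real (card {N..n}) * loss \<le> real n * loss"
    using \<kappa> entropy_term_nonneg[of \<kappa>] \<open>1 \<le> N\<close> by (intro mult_right_mono) (auto simp: loss_def)
  finally have "- ?hits \<le> ?exponent"
    by (simp add: loss_def mult.left_commute)
  moreover have "(real K)\<^sup>2 \<le> 4 * real n powr (4 + \<epsilon>)"
    using power_mono[OF K(3), of 2] by (simp add: power_mult_distrib side(1))
  ultimately have "(real K)\<^sup>2 * exp (- ?hits) \<le> 4 * real n powr (4 + \<epsilon>) * exp ?exponent"
    by (intro mult_mono) auto
  from order_trans[OF A(3) this] A(1,2) show ?thesis
    by blast
qed

lemma missed_cover_prob_le_entropy_growth:
  assumes "0 < \<epsilon>" "1 \<le> N" "N \<le> n"
    and "\<And>m. N \<le> m \<Longrightarrow> \<psi> m \<in> {0..smallness_bound \<epsilon>}"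
  defines "\<kappa> \<equiv> real n powr - (1 + \<epsilon> / 2)"
  shows "\<exists>A\<in>events. missed \<psi> {N..n} \<subseteq> A \<and>
    prob A \<le> 4 * exp (4 * (real n * (\<kappa> + entropy_term \<kappa>)) +
      (4 - \<epsilon>) * (\<Sum>m = 1..<N. entropy_term (\<psi> m))) / entropy_growth \<epsilon> \<psi> n"
proof -
  define cost where "cost = 4 * (real n * (\<kappa> + entropy_term \<kappa>))"
  define weight where "weight = (\<lambda>J. (4 - \<epsilon>) * (\<Sum>m\<in>J. entropy_term (\<psi> m)))"
  have "{1..n} = {1..<N} \<union> {N..n}"
    using assms by auto
  then have "weight {1..n} = weight {1..<N} + weight {N..n}"
    unfolding weight_def distrib_left[symmetric] by (simp only:) (subst sum.union_disjoint, auto)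
  then have "4 * real n powr (4 + \<epsilon>) * exp (cost - weight {N..n}) =
      4 * exp (cost + weight {1..<N}) / (1 / real n powr (4 + \<epsilon>) * exp (weight {1..n}))"
    by (simp add: exp_add exp_diff)
  then show ?thesis
    using missed_cover_prob_le_powr[of \<epsilon> N n \<psi>] assms(1-4)
    unfolding cost_def weight_def \<kappa>_def entropy_growth_def by simp
qed

lemma AE_not_in_missed_tail:
  assumes \<epsilon>: "0 < \<epsilon>" and N: "1 \<le> N"
    and small: "\<And>m. N \<le> m \<Longrightarrow> \<psi> m \<in> {0..smallness_bound \<epsilon>}"
    and unbounded: "\<And>B. \<exists>\<^sub>\<infinity>n. B < entropy_growth \<epsilon> \<psi> n"
  shows "AE \<omega> in M. \<omega> \<notin> missed \<psi> {N..}"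
proof (rule AE_I_small_cover)
  fix e :: real
  assume "0 < e"
  define C where "C = 4 * exp (4 + (4 - \<epsilon>) * (\<Sum>m = 1..<N. entropy_term (\<psi> m)))"
  define cost where "cost = (\<lambda>n. real n *
    (real n powr - (1 + \<epsilon> / 2) + entropy_term (real n powr - (1 + \<epsilon> / 2))))"
  have "\<forall>\<^sub>F n in sequentially. cost n < 1"
    unfolding cost_def using \<epsilon> by (intro order_tendstoD(2)[OF tendsto_mult_powr_entropy_term]) auto
  then have "\<forall>\<^sub>\<infinity>n. cost n < 1 \<and> N \<le> n"
    by (simp add: cofinite_eq_sequentially eventually_conj_iff eventually_ge_at_top)
  from frequently_ex[OF frequently_eventually_frequently[OF unbounded[of "C / e"] this]]
  obtain n where n: "cost n < 1" "N \<le> n" and large: "C / e < entropy_growth \<epsilon> \<psi> n"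
    by blast
  have growth_pos: "0 < entropy_growth \<epsilon> \<psi> n"
    using n(2) N by (simp add: entropy_growth_def)
  obtain A where A: "A \<in> events" "missed \<psi> {N..n} \<subseteq> A"
    "prob A \<le> 4 * exp (4 * cost n + (4 - \<epsilon>) * (\<Sum>m = 1..<N. entropy_term (\<psi> m))) /
      entropy_growth \<epsilon> \<psi> n"
    using missed_cover_prob_le_entropy_growth[where \<psi> = \<psi>, OF \<epsilon> N n(2) small]
    unfolding cost_def by blast
  note A(3)
  also have "\<dots> \<le> C / entropy_growth \<epsilon> \<psi> n"
    unfolding C_def using n(1) growth_pos by (intro divide_right_mono) auto
  also have "\<dots> \<le> e"
    using large \<open>0 < e\<close> growth_pos by (simp add: field_simps)
  finally have "prob A \<le> e" .
  moreover have "missed \<psi> {N..} \<subseteq> missed \<psi> {N..n}"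
    by (fastforce simp: missed_def missed_at_def)
  ultimately show "\<exists>A\<in>events. {\<omega> \<in> space M. \<not> \<omega> \<notin> missed \<psi> {N..}} \<subseteq> A \<and> prob A \<le> e"
    using A(1,2) by blast
qed

lemma AE_INFM_dist_prod_le:
  assumes "0 < \<epsilon>"
    and small: "\<And>m. N \<le> m \<Longrightarrow> \<psi> m \<in> {0..smallness_bound \<epsilon>}"
    and "\<And>B. \<exists>\<^sub>\<infinity>n. B < entropy_growth \<epsilon> \<psi> n"
  shows "AE \<omega> in M. \<forall>\<alpha> \<beta>. \<exists>\<^sub>\<infinity>n. dist_prod \<alpha> \<beta> n \<omega> \<le> \<psi> n"
proof -
  have "AE \<omega> in M. \<omega> \<notin> missed \<psi> {max k (max 1 N)..}" for k
    by (rule AE_not_in_missed_tail[OF assms(1) _ _ assms(3)]) (use small in auto)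
  then have "AE \<omega> in M. \<forall>k. \<omega> \<notin> missed \<psi> {max k (max 1 N)..}"
    by (simp add: AE_all_countable)
  with AE_space show ?thesis
  proof eventually_elim
    case (elim \<omega>)
    show ?case
    proof (intro allI)
      fix \<alpha> \<beta> :: real
      show "\<exists>\<^sub>\<infinity>n. dist_prod \<alpha> \<beta> n \<omega> \<le> \<psi> n"
        unfolding INFM_nat_le
      proof
        fix k
        from elim have "\<not> (\<forall>m\<in>{max k (max 1 N)..}. \<psi> m < dist_prod \<alpha> \<beta> m \<omega>)"
          unfolding missed_def missed_at_def by blast
        then show "\<exists>n\<ge>k. dist_prod \<alpha> \<beta> n \<omega> \<le> \<psi> n"
          by (auto simp: not_less)
      qed
    qed
  qed
qed

lemma AE_INFM_dist_prod_le_of_lower_bound: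
  assumes "0 < c" and lower: "\<And>m. 1 \<le> m \<Longrightarrow> c \<le> \<psi> m"
  shows "AE \<omega> in M. \<forall>\<alpha> \<beta>. \<exists>\<^sub>\<infinity>n. dist_prod \<alpha> \<beta> n \<omega> \<le> \<psi> n"
proof -
  define d where "d = min c (smallness_bound 1)"
  have d: "0 < d" "d \<le> c" "d \<le> smallness_bound 1"
    using \<open>0 < c\<close> by (auto simp: d_def smallness_bound_def)
  have "0 < entropy_term d"
    using d by (auto simp: entropy_term_def smallness_bound_def)
  then have "filterlim (entropy_growth 1 (\<lambda>_. d)) at_top sequentially"
    unfolding entropy_growth_def[abs_def] by (simp only: sum_constant card_atLeastAtMost) real_asymp
  then have unbounded: "\<exists>\<^sub>\<infinity>n. B < entropy_growth 1 (\<lambda>_. d) n" for B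
    by (auto simp: filterlim_at_top_dense cofinite_eq_sequentially intro!: eventually_frequently)
  have "AE \<omega> in M. \<forall>\<alpha> \<beta>. \<exists>\<^sub>\<infinity>n. dist_prod \<alpha> \<beta> n \<omega> \<le> d"
    by (rule AE_INFM_dist_prod_le[OF _ _ unbounded]) (use d in auto)
  then show ?thesis
  proof eventually_elim
    case (elim \<omega>)
    have hit_mono: "\<forall>\<^sub>\<infinity>n. dist_prod \<alpha> \<beta> n \<omega> \<le> d \<longrightarrow> dist_prod \<alpha> \<beta> n \<omega> \<le> \<psi> n" for \<alpha> \<beta>
      unfolding MOST_nat_le using d(2) lower by (meson order_trans)
    show ?case
      by (intro allI frequently_mp[OF hit_mono]) (use elim in blast)
  qed
qed

end

theorem theorem2:
  fixes M :: "'a measure"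
    and \<gamma> \<delta> :: "nat \<Rightarrow> 'a \<Rightarrow> real"
    and \<psi> :: "nat \<Rightarrow> real"
    and \<epsilon> :: real
  assumes "prob_space M"
    and "prob_space.indep_vars M (\<lambda>_. borel) (case_sum \<gamma> \<delta>) ({1..} <+> {1..})"
    and "\<And>n. n \<ge> 1 \<Longrightarrow> distr M borel (\<gamma> n) = uniform_measure lborel {0..<1}"
    and "\<And>n. n \<ge> 1 \<Longrightarrow> distr M borel (\<delta> n) = uniform_measure lborel {0..<1}"
    and "\<And>n. n \<ge> 1 \<Longrightarrow> \<psi> n \<ge> 0"
    and "antimono_on {1..} \<psi>"
    and "\<epsilon> > 0"
    and "limsup (\<lambda>n. ereal (1 / real n powr (4 + \<epsilon>) *
           exp ((4 - \<epsilon>) * (\<Sum>m = 1..n. \<psi> m * ln (1 / \<psi> m))))) = \<infinity>"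
  shows "AE \<omega> in M. \<forall>\<alpha> \<beta> :: real.
           infinite {(n :: nat, a :: int, b :: int). n \<ge> 1 \<and>
             \<bar>\<alpha> + \<gamma> n \<omega> / real n - real_of_int a / real n\<bar> *
             \<bar>\<beta> + \<delta> n \<omega> / real n - real_of_int b / real n\<bar> \<le> \<psi> n / (real n)\<^sup>2}"
proof -
  interpret uniform_shifts M \<gamma> \<delta>
    using assms(1-4) by (simp add: uniform_shifts_def uniform_shifts_axioms_def)
  have "0 < smallness_bound \<epsilon>"
    by (simp add: smallness_bound_def)
  have "AE \<omega> in M. \<forall>\<alpha> \<beta>. \<exists>\<^sub>\<infinity>n. dist_prod \<alpha> \<beta> n \<omega> \<le> \<psi> n"
  proof (cases "\<exists>N\<ge>1. \<psi> N \<le> smallness_bound \<epsilon>")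
    case True
    then obtain N where "N \<ge> 1" "\<psi> N \<le> smallness_bound \<epsilon>"
      by blast
    then have "\<psi> m \<in> {0..smallness_bound \<epsilon>}" if "N \<le> m" for m
      using that assms(5)[of m] monotone_onD[OF assms(6), of N m] by auto
    then show ?thesis
      using INFM_gt_of_limsup_eq_PInfty[OF assms(8)] assms(7)
      by (intro AE_INFM_dist_prod_le) (auto simp: entropy_growth_def entropy_term_def)
  next
    case False
    then show ?thesis
      by (intro AE_INFM_dist_prod_le_of_lower_bound[OF \<open>0 < smallness_bound \<epsilon>\<close>]) (meson linear)
  qed
  then show ?thesis
    by eventually_elim
      (intro allI infinite_approximations_of_INFM_int_dist, simp add: dist_prod_def)
qed

end
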